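(* Let $A\subseteq\omega$ be an $m$-rigid set. Then the many-one degree $\deg_m(A)$ contains an infinite antichain of $1$-degrees; that is, there is an infinite sequence $(B_i)_{i\in\omega}$ of subsets of $\omega$ such that $B_i\equiv_m A$ for every $i$ and $B_i\not\le_1 B_j$ for all $i\neq j$.
   Context: $\omega=\{0,1,2,\dots\}$. For $A,B\subseteq\omega$: $A\le_m B$ if there is a total computable function $f:\omega\to\omega$ such that for all $x$, $x\in A\iff f(x)\in B$; $A\le_1 B$ if there is such an $f$ which is moreover injective. $A\equiv_m B$ means $A\le_m B$ and $B\le_m A$, and $A\equiv_1 B$ means $A\le_1 B$ and $B\le_1 A$. $\deg_m(A)=\{X\subseteq\omega: X\equiv_m A\}$ and $\deg_1(A)=\{X\subseteq\omega: X\equiv_1 A\}$. A total computable function $k:\omega\to\omega$ is an $m$-autoreduction of $A$ if for all $x$, $x\in A\iff k(x)\in A$. The set $A$ is $m$-rigid if every $m$-autoreduction $k$ of $A$ is eventually the identity, i.e. $k(x)=x$ for all but finitely many $x$. *)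

theory Defs
  imports Main
begin

text \<open>Total computable functions are taken to be the unary total functions that are partial
  recursive in the sense of Kleene. Codes carry no arity: \<open>PrimRec\<close> recurses on the first argument
  (its step receives the counter, the previous value, then the parameters), and \<open>Mu\<close> searches over
  the first argument.\<close>

datatype recf =
    Zero
  | Succ
  | Proj nat
  | Comp recf "recf list"
  | PrimRec recf recf
  | Mu recf

inductive evaluates :: "recf \<Rightarrow> nat list \<Rightarrow> nat \<Rightarrow> bool" where
  Zero: "evaluates Zero xs 0"
| Succ: "evaluates Succ [x] (Suc x)"
| Proj: "i < length xs \<Longrightarrow> evaluates (Proj i) xs (xs ! i)"
| Comp: "list_all2 (\<lambda>g y. evaluates g xs y) gs ys \<Longrightarrow> evaluates f ys z
    \<Longrightarrow> evaluates (Comp f gs) xs z"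
| PrimRec_0: "evaluates f xs y \<Longrightarrow> evaluates (PrimRec f g) (0 # xs) y"
| PrimRec_Suc: "evaluates (PrimRec f g) (n # xs) y \<Longrightarrow> evaluates g (n # y # xs) z
    \<Longrightarrow> evaluates (PrimRec f g) (Suc n # xs) z"
| Mu: "evaluates f (n # xs) 0 \<Longrightarrow> (\<And>m. m < n \<Longrightarrow> \<exists>y. evaluates f (m # xs) (Suc y))
    \<Longrightarrow> evaluates (Mu f) xs n"

lemma evaluates_functional:
  assumes "evaluates p xs y" and "evaluates p xs y'"
  shows "y = y'"
  using assms
proof (induction p xs y arbitrary: y' rule: evaluates.induct)
  case (Comp xs gs ys f z)
  from Comp.prems obtain ys' where ys': "list_all2 (\<lambda>g y. evaluates g xs y) gs ys'"
    and f: "evaluates f ys' y'"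
    by (cases rule: evaluates.cases) auto
  have "ys = ys'"
    using Comp.IH(1) ys' by (auto simp: list_all2_conv_all_nth intro: nth_equalityI)
  with Comp.IH(2) f show ?case by blast
next
  case (PrimRec_Suc f g n xs y z)
  from PrimRec_Suc.prems obtain v where "evaluates (PrimRec f g) (n # xs) v"
    and "evaluates g (n # v # xs) y'"
    by (cases rule: evaluates.cases) auto
  with PrimRec_Suc.IH show ?case by blast
next
  case (Mu f n xs)
  from Mu.prems have 0: "evaluates f (y' # xs) 0"
    and below: "\<And>m. m < y' \<Longrightarrow> \<exists>y. evaluates f (m # xs) (Suc y)"
    by (cases rule: evaluates.cases; auto)+
  show ?case
  proof (cases n y' rule: linorder_cases)
    case less
    with below Mu.IH(1) show ?thesis by blast
  next
    case greater
    with Mu.IH(2) 0 show ?thesis by blast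
  qed
qed (erule evaluates.cases; simp)+

definition computable :: "(nat \<Rightarrow> nat) \<Rightarrow> bool" where
  "computable f \<longleftrightarrow> (\<exists>p. \<forall>x. evaluates p [x] (f x))"

definition many_one_reducible :: "nat set \<Rightarrow> nat set \<Rightarrow> bool" (infix "\<le>\<^sub>m" 50) where
  "A \<le>\<^sub>m B \<longleftrightarrow> (\<exists>f. computable f \<and> (\<forall>x. x \<in> A \<longleftrightarrow> f x \<in> B))"

definition one_one_reducible :: "nat set \<Rightarrow> nat set \<Rightarrow> bool" (infix "\<le>\<^sub>1" 50) where
  "A \<le>\<^sub>1 B \<longleftrightarrow> (\<exists>f. computable f \<and> inj f \<and> (\<forall>x. x \<in> A \<longleftrightarrow> f x \<in> B))"

definition many_one_equivalent :: "nat set \<Rightarrow> nat set \<Rightarrow> bool" (infix "\<equiv>\<^sub>m" 50) where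
  "A \<equiv>\<^sub>m B \<longleftrightarrow> A \<le>\<^sub>m B \<and> B \<le>\<^sub>m A"

definition m_autoreduction :: "(nat \<Rightarrow> nat) \<Rightarrow> nat set \<Rightarrow> bool" where
  "m_autoreduction k A \<longleftrightarrow> computable k \<and> (\<forall>x. x \<in> A \<longleftrightarrow> k x \<in> A)"

definition m_rigid :: "nat set \<Rightarrow> bool" where
  "m_rigid A \<longleftrightarrow> (\<forall>k. m_autoreduction k A \<longrightarrow> finite {x. k x \<noteq> x})"

end

theory Submission imports Defs begin

text \<open>Take \<open>B\<^sub>i\<close> to be the preimage of \<open>A\<close> under a computable surjection \<open>f\<^sub>i\<close> whose fibre over
  \<open>y > 0\<close> has two elements if bit \<open>i\<close> of \<open>y\<close> is set, and one element otherwise. If \<open>h\<close> reduces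
  \<open>B\<^sub>i\<close> to \<open>B\<^sub>j\<close>, then composing a computable section of \<open>f\<^sub>i\<close> with \<open>h\<close> and \<open>f\<^sub>j\<close> gives an
  autoreduction of \<open>A\<close>, so by rigidity \<open>h\<close> maps the fibre of \<open>f\<^sub>i\<close> over \<open>y\<close> into that of \<open>f\<^sub>j\<close> for
  almost all \<open>y\<close>. Infinitely many \<open>y\<close> have bit \<open>i\<close> set and bit \<open>j\<close> clear, so \<open>h\<close> is not injective.\<close>

text \<open>\<open>computable\<close> covers unary functions only; addition, multiplication and the
  steps of recursions need two arguments.\<close>

definition computable2 :: "(nat \<Rightarrow> nat \<Rightarrow> nat) \<Rightarrow> bool" where
  "computable2 f \<longleftrightarrow> (\<exists>p. \<forall>x y. evaluates p [x, y] (f x y))"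

lemma evaluates_Comp1:
  "evaluates q xs y \<Longrightarrow> evaluates p [y] z \<Longrightarrow> evaluates (Comp p [q]) xs z"
  by (rule evaluates.Comp[where ys = "[y]"]) auto

lemma evaluates_Comp2:
  "evaluates q xs y \<Longrightarrow> evaluates r xs y' \<Longrightarrow> evaluates p [y, y'] z
    \<Longrightarrow> evaluates (Comp p [q, r]) xs z"
  by (rule evaluates.Comp[where ys = "[y, y']"]) auto

lemma evaluates_Proj_eq: "i < length xs \<Longrightarrow> xs ! i = y \<Longrightarrow> evaluates (Proj i) xs y"
  using evaluates.Proj by blast

text \<open>One code serves argument lists of every length; in \<open>computable_primrec\<close> the
  base case runs on the empty list.\<close>

lemma evaluates_const: "\<exists>p. \<forall>xs. evaluates p xs c"
proof (induction c)
  case 0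
  show ?case by (blast intro: evaluates.Zero)
next
  case (Suc c)
  then show ?case by (blast intro: evaluates_Comp1 evaluates.Succ)
qed

lemma computable_id: "computable (\<lambda>x. x)"
  unfolding computable_def by (rule exI[of _ "Proj 0"]) (simp add: evaluates_Proj_eq)

lemma computable_const: "computable (\<lambda>x. c)"
  unfolding computable_def using evaluates_const by blast

lemma computable_Suc: "computable Suc"
  unfolding computable_def by (blast intro: evaluates.Succ)

lemma computable_compose:
  assumes "computable f" "computable g"
  shows "computable (\<lambda>x. f (g x))"
  using assms unfolding computable_def by (blast intro: evaluates_Comp1)

lemma computable2_compose:
  assumes "computable2 f" "computable g" "computable h"
  shows "computable (\<lambda>x. f (g x) (h x))"
  using assms unfolding computable_def computable2_def by (blast intro: evaluates_Comp2)

lemma computable2_fst: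
  assumes "computable f"
  shows "computable2 (\<lambda>x y. f x)"
proof -
  have "evaluates (Proj 0) [x, y] x" for x y by (simp add: evaluates_Proj_eq)
  with assms show ?thesis
    unfolding computable_def computable2_def by (blast intro: evaluates_Comp1)
qed

lemma computable2_snd:
  assumes "computable f"
  shows "computable2 (\<lambda>x y. f y)"
proof -
  have "evaluates (Proj 1) [x, y] y" for x y by (simp add: evaluates_Proj_eq)
  with assms show ?thesis
    unfolding computable_def computable2_def by (blast intro: evaluates_Comp1)
qed

lemma computable2_compose2:
  assumes "computable2 f" "computable2 g" "computable2 h"
  shows "computable2 (\<lambda>x y. f (g x y) (h x y))"
proof -
  obtain p q r where "\<And>x y. evaluates p [x, y] (f x y)"
    and "\<And>x y. evaluates q [x, y] (g x y)" and "\<And>x y. evaluates r [x, y] (h x y)"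
    using assms unfolding computable2_def by metis
  then have "evaluates (Comp p [q, r]) [x, y] (f (g x y) (h x y))" for x y
    by (intro evaluates_Comp2)
  then show ?thesis unfolding computable2_def by blast
qed

lemma computable2_add: "computable2 (+)"
proof -
  have "evaluates (PrimRec (Proj 0) (Comp Succ [Proj 1])) [x, y] (x + y)" for x y
  proof (induction x)
    case 0
    show ?case by (auto intro!: evaluates.PrimRec_0 evaluates_Proj_eq)
  next
    case (Suc x)
    have "evaluates (Comp Succ [Proj 1]) [x, x + y, y] (Suc x + y)"
      by (rule evaluates_Comp1[where y = "x + y"])
        (auto intro: evaluates_Proj_eq evaluates.Succ)
    with Suc show ?case by (rule evaluates.PrimRec_Suc)
  qed
  then show ?thesis unfolding computable2_def by blast
qed

lemma computable2_mult: "computable2 (*)"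
proof -
  obtain p where p: "\<And>x y. evaluates p [x, y] (x + y)"
    using computable2_add unfolding computable2_def by blast
  \<comment> \<open>In the step, \<open>Proj 1\<close> is the previous value and
    \<open>Proj 2\<close> the parameter \<open>y\<close>.\<close>
  have "evaluates (PrimRec Zero (Comp p [Proj 1, Proj 2])) [x, y] (x * y)" for x y
  proof (induction x)
    case 0
    show ?case by (auto intro!: evaluates.PrimRec_0 evaluates.Zero)
  next
    case (Suc x)
    have "evaluates (Comp p [Proj 1, Proj 2]) [x, x * y, y] (Suc x * y)"
      using p[of "x * y" y]
      by (intro evaluates_Comp2[where y = "x * y" and y' = y])
        (auto intro: evaluates_Proj_eq simp: add.commute)
    with Suc show ?case by (rule evaluates.PrimRec_Suc)
  qed
  then show ?thesis unfolding computable2_def by blast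
qed

text \<open>Recursion without parameters: the base value \<open>f 0\<close> is a constant, hence
  computable, so applications only have to verify the recurrence.\<close>

lemma computable_primrec:
  assumes g: "computable2 g" and f: "\<And>n. f (Suc n) = g n (f n)"
  shows "computable f"
proof -
  obtain p where p: "\<And>x y. evaluates p [x, y] (g x y)"
    using g unfolding computable2_def by blast
  obtain q where q: "\<And>xs. evaluates q xs (f 0)"
    using evaluates_const by blast
  have "evaluates (PrimRec q p) [n] (f n)" for n
  proof (induction n)
    case 0
    show ?case by (intro evaluates.PrimRec_0 q)
  next
    case (Suc n)
    with p[of n "f n"] show ?case unfolding f by (blast intro: evaluates.PrimRec_Suc)
  qed
  then show ?thesis unfolding computable_def by blast
qed

text \<open>Truncated subtraction acts as negation on truth values 0 and 1.\<close>

lemma computable_one_minus: "computable (\<lambda>n. 1 - n)"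
  by (rule computable_primrec[OF computable2_fst[OF computable_const[of 0]]]) simp

lemma computable_of_bool_odd: "computable (\<lambda>n. of_bool (odd n))"
  by (rule computable_primrec[OF computable2_snd[OF computable_one_minus]]) simp

lemma computable_div2: "computable (\<lambda>n. n div 2)"
proof (rule computable_primrec)
  show "computable2 (\<lambda>n y. of_bool (odd n) + y)"
    by (rule computable2_compose2[OF computable2_add computable2_fst[OF computable_of_bool_odd]
          computable2_snd[OF computable_id]])
  show "Suc n div 2 = of_bool (odd n) + n div 2" for n :: nat
    by (cases "even n") auto
qed

lemma computable_of_bool_bit: "computable (\<lambda>n. of_bool (bit n i))"
proof (induction i)
  case 0
  show ?case using computable_of_bool_odd by (simp add: bit_0)
next
  case (Suc i)
  from computable_compose[OF this computable_div2] show ?case by (simp add: bit_Suc)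
qed

lemma computable_if:
  assumes P: "computable (\<lambda>x. of_bool (P x))" and f: "computable f" and g: "computable g"
  shows "computable (\<lambda>x. if P x then f x else g x)"
proof -
  have "computable (\<lambda>x. of_bool (P x) * f x + (1 - of_bool (P x)) * g x)"
    by (intro computable2_compose[OF computable2_add] computable2_compose[OF computable2_mult]
        computable_compose[OF computable_one_minus] P f g)
  moreover have "of_bool (P x) * f x + (1 - of_bool (P x)) * g x = (if P x then f x else g x)"
    for x by simp
  ultimately show ?thesis by simp
qed

lemma computable_double: "computable (\<lambda>n. 2 * n)"
  by (rule computable2_compose[OF computable2_mult computable_const computable_id])

lemma infinite_bit_set_bit_clear:
  assumes "i \<noteq> j"
  shows "infinite {y :: nat. bit y i \<and> \<not> bit y j}"
  unfolding finite_nat_set_iff_bounded not_ex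
proof
  fix m :: nat
  define n where "n = Suc (m + i + j)"
  \<comment> \<open>As \<open>n\<close> exceeds \<open>m\<close>, \<open>i\<close> and
    \<open>j\<close>, setting bit \<open>n\<close> makes \<open>y\<close> large without touching
    bits \<open>i\<close> and \<open>j\<close>.\<close>
  define y :: nat where "y = set_bit n (2 ^ i)"
  have "2 ^ n \<le> y"
    unfolding y_def n_def set_bit_eq by (auto simp: bit_simps)
  moreover have "n < 2 ^ n" by (rule less_exp)
  ultimately have "m < y" unfolding n_def by linarith
  moreover have "bit y i" "\<not> bit y j"
    using assms unfolding y_def n_def by (auto simp: bit_simps)
  ultimately show "\<not> (\<forall>y \<in> {y. bit y i \<and> \<not> bit y j}. y < m)" by auto
qed

text \<open>The point \<open>2 * y\<close> always lies over \<open>y\<close>, and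
  \<open>2 * y + 1\<close> joins it when bit \<open>i\<close> of \<open>y\<close> is set. All other
  odd numbers are discarded into the fibre over 0.\<close>

definition bit_cover :: "nat \<Rightarrow> nat \<Rightarrow> nat" where
  "bit_cover i x = (if odd x then if bit (x div 2) i then x div 2 else 0 else x div 2)"

lemma computable_bit_cover: "computable (bit_cover i)"
  unfolding bit_cover_def
  by (intro computable_if computable_of_bool_odd computable_div2 computable_const
      computable_compose[OF computable_of_bool_bit computable_div2])

lemma bit_cover_double [simp]: "bit_cover i (2 * y) = y"
  by (simp add: bit_cover_def)

lemma bit_cover_Suc_double: "bit y i \<Longrightarrow> bit_cover i (Suc (2 * y)) = y"
  by (simp add: bit_cover_def)

text \<open>An odd \<open>x\<close> maps either to a number with bit \<open>j\<close> set or to the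
  default 0; positivity of \<open>y\<close> rules out the latter.\<close>

lemma bit_cover_eqD:
  assumes "bit_cover j x = y" "0 < y" "\<not> bit y j"
  shows "x = 2 * y"
  using assms by (auto simp: bit_cover_def split: if_splits)

text \<open>\<open>bit_cover i\<close> is itself one reduction, and its section, doubling, is the
  other.\<close>

lemma vimage_bit_cover_m_equivalent: "bit_cover i -` A \<equiv>\<^sub>m A"
  unfolding many_one_equivalent_def many_one_reducible_def
  using computable_bit_cover computable_double by (metis bit_cover_double vimage_eq)

lemma vimage_bit_cover_not_one_one_reducible:
  assumes "m_rigid A" "i \<noteq> j"
  shows "\<not> bit_cover i -` A \<le>\<^sub>1 bit_cover j -` A"
proof
  assume "bit_cover i -` A \<le>\<^sub>1 bit_cover j -` A"
  then obtain h where h: "computable h" "inj h"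
    and red: "\<And>x. bit_cover i x \<in> A \<longleftrightarrow> bit_cover j (h x) \<in> A"
    unfolding one_one_reducible_def by auto
  define k where "k y = bit_cover j (h (2 * y))" for y
  \<comment> \<open>While \<open>k\<close> follows the even point of each fibre, \<open>k'\<close>
    follows the odd one. Where bit \<open>i\<close> is clear there is no odd point over
    \<open>y\<close>, and the default \<open>y\<close> keeps \<open>k'\<close> an
    autoreduction.\<close>
  define k' where "k' y = (if bit y i then bit_cover j (h (Suc (2 * y))) else y)" for y
  have "m_autoreduction k A"
    unfolding m_autoreduction_def
  proof (intro conjI allI)
    show "computable k"
      unfolding k_def
      by (intro computable_compose[OF computable_bit_cover] computable_compose[OF h(1)]
          computable_double)
    show "y \<in> A \<longleftrightarrow> k y \<in> A" for y
      using red[of "2 * y"] by (simp add: k_def)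
  qed
  moreover have "m_autoreduction k' A"
    unfolding m_autoreduction_def
  proof (intro conjI allI)
    show "computable k'"
      unfolding k'_def
      by (intro computable_if computable_of_bool_bit computable_id
          computable_compose[OF computable_bit_cover] computable_compose[OF h(1)]
          computable_compose[OF computable_Suc] computable_double)
    show "y \<in> A \<longleftrightarrow> k' y \<in> A" for y
      by (cases "bit y i") (simp_all add: k'_def red[symmetric] bit_cover_Suc_double)
  qed
  ultimately have "finite ({y. k y \<noteq> y} \<union> {y. k' y \<noteq> y})"
    using assms(1) unfolding m_rigid_def by simp
  with infinite_bit_set_bit_clear[OF assms(2)]
  have "\<not> {y. bit y i \<and> \<not> bit y j} \<subseteq> {y. k y \<noteq> y} \<union> {y. k' y \<noteq> y}"
    using finite_subset by metis
  then obtain y where y: "bit y i" "\<not> bit y j" "k y = y" "k' y = y"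
    by blast
  have "0 < y" using y(1) by (intro gr0I) simp
  \<comment> \<open>Over this \<open>y\<close> the fibre of \<open>bit_cover j\<close> is a single
    point, which forces both values of \<open>h\<close>.\<close>
  have "h (2 * y) = 2 * y"
    using y \<open>0 < y\<close> by (intro bit_cover_eqD) (auto simp: k_def)
  moreover have "h (Suc (2 * y)) = 2 * y"
    using y \<open>0 < y\<close> by (intro bit_cover_eqD) (auto simp: k'_def)
  ultimately have "2 * y = Suc (2 * y)"
    using h(2) by (metis injD)
  then show False by simp
qed

theorem theorem3p1:
  fixes A :: "nat set"
  assumes "m_rigid A"
  shows "\<exists>B :: nat \<Rightarrow> nat set.
    (\<forall>i. B i \<equiv>\<^sub>m A) \<and> (\<forall>i j. i \<noteq> j \<longrightarrow> \<not> B i \<le>\<^sub>1 B j)"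
  using vimage_bit_cover_m_equivalent vimage_bit_cover_not_one_one_reducible[OF assms]
  by (intro exI[of _ "\<lambda>i. bit_cover i -` A"]) blast

end
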